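(* Consider the portfolio optimization problem $$P^{\mathrm{portfolio}}:\quad\min_{\mathbf x\in\mathbb R^n,\,\mathbf r\in\mathbb R^m}\left\{f(\mathbf r)\ \Big|\ \sum_{j=1}^n\boldsymbol\alpha_jx_j=\mathbf r,\ \mathbf 1^T\mathbf x=1,\ \mathbf x\ge\mathbf 0\right\},$$ where the vectors $\boldsymbol\alpha_j=(\alpha_{ij})_{i\in[m]}\in\mathbb R^m$ satisfy $\|\boldsymbol\alpha_j\|_2\le H$ for all $j\in[n]$ and $f:\mathbb R^m\to\mathbb R$ is Lipschitz continuous with Lipschitz constant $L$. Let $C\ge1$ be an arbitrary constant and define $$P^{\mathrm{portfolio}}_{\mathrm{distr}}:\quad\min_{\mathbf x,\mathbf r}\left\{f(\mathbf r)\ \Big|\ \sum_{j=1}^n\boldsymbol\alpha_jx_j=\mathbf r,\ \mathbf 1^T\mathbf x=1,\ \mathbf 0\le\mathbf x\le C\boldsymbol\xi\right\}.$$ Let $J=\{j_1,\dots,j_K\}$ be drawn i.i.d. from $\boldsymbol\xi$ and let $$P^{\mathrm{portfolio}}_J:\quad\min\left\{f(\mathbf r)\ \Big|\ \sum_{j\in J}\boldsymbol\alpha_j\tilde x_j=\mathbf r,\ \sum_{j\in J}\tilde x_j=1,\ \tilde{\mathbf x}\ge\mathbf 0\right\}.$$ Denote by $F$, $F_{\mathrm{distr}}$ and $F_J$ the optimal objective values of $P^{\mathrm{portfolio}}$, $P^{\mathrm{portfolio}}_{\mathrm{distr}}$ and $P^{\mathrm{portfolio}}_J$, respectively, and let $\Delta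 F_J=F_J-F$ and $\Delta F_{\mathrm{distr}}=F_{\mathrm{distr}}-F$. Then for any $\delta\in(0,1)$, with probability at least $1-\delta$, $$\Delta F_J\le\Delta F_{\mathrm{distr}}+\frac{CLH}{\sqrt K}\left(1+3\sqrt{\frac12\log\frac4\delta}\right).$$
   Context: $[n]=\{1,\dots,n\}$, $[m]=\{1,\dots,m\}$, and $\mathbf 1$ is the all-ones vector. $\boldsymbol\xi=(\xi_1,\dots,\xi_n)$ is a probability distribution on $[n]$; the indices $j_1,\dots,j_K$ are independent with $\Pr[j_k=t]=\xi_t$ (repetitions possible). Lipschitz continuity is with respect to the Euclidean norm; $f$ need not be linear or convex. *)

theory Defs
  imports "HOL-Probability.Probability"
begin

(* An optimization problem is given by its feasible set of pairs (x, r); the objective f only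
   depends on r. For continuous f the feasible sets below are nonempty (for C >= 1 and a
   probability vector \<xi>, and for nonempty J, respectively) and their projections to r are compact, so the infimum is an
   attained minimum and not a junk value. *)
definition optimal_value :: "('r \<Rightarrow> real) \<Rightarrow> ('x \<times> 'r) set \<Rightarrow> real" where
  "optimal_value f S = (INF (x, r) \<in> S. f r)"

definition portfolio_feasible ::
    "('n::finite \<Rightarrow> real ^ 'm::finite) \<Rightarrow> ((real ^ 'n) \<times> (real ^ 'm)) set" where
  "portfolio_feasible \<alpha> =
     {(x, r). (\<Sum>j\<in>UNIV. x $ j *\<^sub>R \<alpha> j) = r \<and> (\<Sum>j\<in>UNIV. x $ j) = 1 \<and> (\<forall>j. 0 \<le> x $ j)}"

definition portfolio_distr_feasible ::
    "real \<Rightarrow> real ^ 'n \<Rightarrow> ('n::finite \<Rightarrow> real ^ 'm::finite) \<Rightarrow> ((real ^ 'n) \<times> (real ^ 'm)) set" where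
  "portfolio_distr_feasible C \<xi> \<alpha> =
     {(x, r). (\<Sum>j\<in>UNIV. x $ j *\<^sub>R \<alpha> j) = r \<and> (\<Sum>j\<in>UNIV. x $ j) = 1 \<and>
              (\<forall>j. 0 \<le> x $ j \<and> x $ j \<le> C * \<xi> $ j)}"

(* The variables of the sampled problem are indexed by J only; extensional J represents the
   vectors in R^J by functions with a fixed value outside J. *)
definition portfolio_sample_feasible ::
    "'n set \<Rightarrow> ('n::finite \<Rightarrow> real ^ 'm::finite) \<Rightarrow> (('n \<Rightarrow> real) \<times> (real ^ 'm)) set" where
  "portfolio_sample_feasible J \<alpha> =
     {(x, r). x \<in> extensional J \<and>
              (\<Sum>j\<in>J. x j *\<^sub>R \<alpha> j) = r \<and> (\<Sum>j\<in>J. x j) = 1 \<and> (\<forall>j\<in>J. 0 \<le> x j)}"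

end

theory Submission
  imports Defs
begin

text \<open>
  Let \<open>(x, r)\<close> be optimal for the problem with the bound \<open>C \<xi>\<close> and put
  \<open>y\<^sub>t = x\<^sub>t / \<xi>\<^sub>t \<in> [0, C]\<close>. The sample means \<open>S\<close> of \<open>y\<^sub>j\<close> and \<open>V\<close> of \<open>y\<^sub>j \<alpha>\<^sub>j\<close> have expectations
  \<open>1\<close> and \<open>r\<close>, and \<open>V / S\<close> is feasible for the sampled problem. As \<open>V / S\<close> has norm at most \<open>H\<close>,
  its distance to \<open>r\<close> is at most \<open>H \<bar>1 - S\<bar> + \<parallel>V - r\<parallel>\<close>. McDiarmid's inequality controls both terms:
  each of the two tails of \<open>S\<close> and the tail of \<open>\<parallel>V - r\<parallel>\<close>, whose expectation is at most \<open>C H / sqrt K\<close>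
  by a variance computation, has probability at most \<open>\<delta> / 4\<close>.
\<close>

subsection \<open>McDiarmid's inequality\<close>

lemma finite_set_Pi_pmf:
  assumes "finite A" "\<And>i. i \<in> A \<Longrightarrow> finite (set_pmf (p i))"
  shows "finite (set_pmf (Pi_pmf A d p))"
  using assms by (auto simp: set_Pi_pmf)

text \<open>Fubini for one coordinate, used to split off a coordinate in the inductions below.
  Finite supports make every integrand integrable, so \<open>h\<close> can be arbitrary.\<close>

lemma expectation_Pi_pmf_insert:
  fixes h :: "('i \<Rightarrow> 'b) \<Rightarrow> 'c :: {banach, second_countable_topology}"
  assumes "finite A" "x \<notin> A" "\<And>i. i \<in> insert x A \<Longrightarrow> finite (set_pmf (p i))"
  shows "measure_pmf.expectation (Pi_pmf (insert x A) d p) h =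
    measure_pmf.expectation (p x) (\<lambda>y. measure_pmf.expectation (Pi_pmf A d p) (\<lambda>a. h (a(x := y))))"
proof -
  have eq: "Pi_pmf (insert x A) d p =
      p x \<bind> (\<lambda>y. map_pmf (\<lambda>a. a(x := y)) (Pi_pmf A d p))"
    using assms by (subst Pi_pmf_insert') (auto simp: map_pmf_def)
  have fin: "finite (set_pmf (Pi_pmf A d p))"
    using assms by (intro finite_set_Pi_pmf) auto
  show ?thesis
    unfolding eq using assms fin
    by (subst pmf_expectation_bind[of "set_pmf (p x)"])
       (auto simp: integral_measure_pmf[of "set_pmf (p x)"])
qed

text \<open>Hoeffding's lemma with the interval replaced by the oscillation of \<open>h\<close>: its
  minimum over the support is the left end of an interval of length \<open>c\<close>. The mean stays
  in the exponent so that the bound can be iterated over coordinates.\<close>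

lemma Hoeffdings_lemma_pmf:
  fixes h :: "'b \<Rightarrow> real"
  assumes fin: "finite (set_pmf p)" and s: "s > 0"
    and diff: "\<And>x y. x \<in> set_pmf p \<Longrightarrow> y \<in> set_pmf p \<Longrightarrow> h x - h y \<le> c"
  shows "measure_pmf.expectation p (\<lambda>x. exp (s * h x))
    \<le> exp (s * measure_pmf.expectation p h + s\<^sup>2 * c\<^sup>2 / 8)"
proof -
  define a where "a = Min (h ` set_pmf p)"
  have "a \<in> h ` set_pmf p"
    unfolding a_def using fin set_pmf_not_empty by (intro Min_in) auto
  then obtain y where y: "y \<in> set_pmf p" "a = h y" by auto
  have range: "h x \<in> {a..a + c}" if "x \<in> set_pmf p" for x
  proof -
    have "a \<le> h x"
      unfolding a_def using that fin by (intro Min_le) auto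
    then show ?thesis using diff[OF that y(1)] y(2) by auto
  qed
  interpret interval_bounded_random_variable "measure_pmf p" h a "a + c"
  proof unfold_locales
    show "AE x in p. h x \<in> {a..a + c}"
      by (intro AE_pmfI range)
  qed simp
  let ?\<mu> = "measure_pmf.expectation p h"
  have "ennreal (measure_pmf.expectation p (\<lambda>x. exp (s * (h x - ?\<mu>)))) =
      nn_integral p (\<lambda>x. exp (s * (h x - ?\<mu>)))"
    by (rule nn_integral_eq_integral[symmetric]) (auto intro: integrable_measure_pmf_finite fin)
  also have "\<dots> \<le> ennreal (exp (s\<^sup>2 * (a + c - a)\<^sup>2 / 8))"
    using Hoeffdings_lemma_nn_integral[OF s] by simp
  finally have "measure_pmf.expectation p (\<lambda>x. exp (s * (h x - ?\<mu>))) \<le> exp (s\<^sup>2 * c\<^sup>2 / 8)"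
    by (simp add: ennreal_le_iff)
  moreover have "measure_pmf.expectation p (\<lambda>x. exp (s * (h x - ?\<mu>))) =
      measure_pmf.expectation p (\<lambda>x. exp (s * h x)) / exp (s * ?\<mu>)"
    by (simp add: right_diff_distrib exp_diff)
  ultimately show ?thesis
    by (simp only: exp_add pos_divide_le_eq exp_gt_zero mult.commute)
qed

text \<open>Induction on the coordinates takes the place of a martingale argument. With coordinate
  \<open>i\<close> fixed to \<open>y\<close>, the induction hypothesis bounds the inner expectation
  through the partial mean \<open>E y\<close>. Since \<open>E\<close> oscillates by at most
  \<open>c i\<close>, Hoeffding's lemma handles the outer expectation and adds the summand for
  \<open>i\<close>.\<close>

lemma bounded_differences_mgf_le:
  fixes h :: "('i \<Rightarrow> 'b) \<Rightarrow> real"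
  assumes "finite A" "s > 0"
    and "\<And>i. i \<in> A \<Longrightarrow> finite (set_pmf (p i))"
    and "\<And>i a y z. i \<in> A \<Longrightarrow> y \<in> set_pmf (p i) \<Longrightarrow> z \<in> set_pmf (p i) \<Longrightarrow> h (a(i := y)) - h (a(i := z)) \<le> c i"
  shows "measure_pmf.expectation (Pi_pmf A d p) (\<lambda>a. exp (s * h a))
    \<le> exp (s * measure_pmf.expectation (Pi_pmf A d p) h + s\<^sup>2 * (\<Sum>i\<in>A. (c i)\<^sup>2) / 8)"
  using assms(1,3,4)
proof (induction A arbitrary: h rule: finite_induct)
  case empty
  then show ?case by simp
next
  case (insert i A)
  define P where "P = Pi_pmf A d p"
  define E where "E y = measure_pmf.expectation P (\<lambda>a. h (a(i := y)))" for y
  let ?V = "s\<^sup>2 * (\<Sum>i\<in>A. (c i)\<^sup>2) / 8"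
  have finP: "finite (set_pmf P)"
    unfolding P_def using insert by (intro finite_set_Pi_pmf) auto
  note intP = integrable_measure_pmf_finite[OF finP]
  have fini: "finite (set_pmf (p i))" using insert.prems by auto
  have IH: "measure_pmf.expectation P (\<lambda>a. exp (s * h (a(i := y)))) \<le> exp (s * E y + ?V)"
    if "y \<in> set_pmf (p i)" for y
    unfolding P_def E_def
  proof (rule insert.IH)
    fix j a u v assume j: "j \<in> A" "u \<in> set_pmf (p j)" "v \<in> set_pmf (p j)"
    then have "i \<noteq> j" using insert.hyps by auto
    then show "h (a(j := u, i := y)) - h (a(j := v, i := y)) \<le> c j"
      using insert.prems(2)[OF insertI2[OF j(1)] j(2,3), of "a(i := y)"]
      by (simp only: fun_upd_twist[OF \<open>i \<noteq> j\<close>])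
  qed (use insert.prems in auto)
  \<comment> \<open>Both means average over the same remaining coordinates, so the pointwise bound
    survives integration.\<close>
  have E_diff: "E y - E z \<le> c i" if "y \<in> set_pmf (p i)" "z \<in> set_pmf (p i)" for y z
  proof -
    have "E y - E z = measure_pmf.expectation P (\<lambda>a. h (a(i := y)) - h (a(i := z)))"
      unfolding E_def by (intro Bochner_Integration.integral_diff[symmetric] intP)
    also have "\<dots> \<le> measure_pmf.expectation P (\<lambda>a. c i)"
      by (intro integral_mono intP insert.prems(2) that) auto
    finally show ?thesis by simp
  qed
  have "measure_pmf.expectation (Pi_pmf (insert i A) d p) (\<lambda>a. exp (s * h a)) =
      measure_pmf.expectation (p i) (\<lambda>y. measure_pmf.expectation P (\<lambda>a. exp (s * h (a(i := y)))))"
    unfolding P_def using insert by (intro expectation_Pi_pmf_insert) auto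
  also have "\<dots> \<le> measure_pmf.expectation (p i) (\<lambda>y. exp (s * E y) * exp ?V)"
    by (intro integral_mono_AE integrable_measure_pmf_finite fini AE_pmfI)
       (use IH in \<open>simp add: exp_add\<close>)
  also have "\<dots> = measure_pmf.expectation (p i) (\<lambda>y. exp (s * E y)) * exp ?V"
    by simp
  also have "\<dots> \<le> exp (s * measure_pmf.expectation (p i) E + s\<^sup>2 * (c i)\<^sup>2 / 8) * exp ?V"
    by (intro mult_right_mono Hoeffdings_lemma_pmf fini assms(2) E_diff) auto
  also have "measure_pmf.expectation (p i) E = measure_pmf.expectation (Pi_pmf (insert i A) d p) h"
    unfolding P_def E_def using insert by (intro expectation_Pi_pmf_insert[symmetric]) auto
  finally show ?case
    using insert.hyps by (simp add: exp_add[symmetric] algebra_simps add_divide_distrib)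
qed

text \<open>Chernoff's method: Markov's inequality for \<open>exp (s * h a)\<close> together with
  the preceding bound. The difference hypothesis is one-sided only in appearance, since
  \<open>y\<close> and \<open>z\<close> may be exchanged.\<close>

lemma McDiarmid_inequality_pmf:
  fixes h :: "('i \<Rightarrow> 'b) \<Rightarrow> real"
  assumes A: "finite A" and fin: "\<And>i. i \<in> A \<Longrightarrow> finite (set_pmf (p i))"
    and diff: "\<And>i a y z. i \<in> A \<Longrightarrow> y \<in> set_pmf (p i) \<Longrightarrow> z \<in> set_pmf (p i) \<Longrightarrow> h (a(i := y)) - h (a(i := z)) \<le> c i"
    and t: "t > 0" and pos: "(\<Sum>i\<in>A. (c i)\<^sup>2) > 0"
  shows "measure_pmf.prob (Pi_pmf A d p) {a. h a \<ge> measure_pmf.expectation (Pi_pmf A d p) h + t}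
    \<le> exp (- 2 * t\<^sup>2 / (\<Sum>i\<in>A. (c i)\<^sup>2))"
proof -
  define P where "P = Pi_pmf A d p"
  define \<mu> where "\<mu> = measure_pmf.expectation P h"
  define V where "V = (\<Sum>i\<in>A. (c i)\<^sup>2)"
  define s where "s = 4 * t / V" \<comment> \<open>minimizes the exponent \<open>s\<^sup>2 V / 8 - s t\<close>\<close>
  have V: "V > 0" using pos by (simp add: V_def)
  have s: "s > 0" using t V by (simp add: s_def)
  have finP: "finite (set_pmf P)"
    unfolding P_def by (intro finite_set_Pi_pmf A fin)
  have "{a. h a \<ge> \<mu> + t} = {a \<in> space P. exp (s * h a) \<ge> exp (s * (\<mu> + t))}"
    using s by simp
  also have "measure_pmf.prob P \<dots> \<le>
      measure_pmf.expectation P (\<lambda>a. exp (s * h a)) / exp (s * (\<mu> + t))"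
    by (rule integral_Markov_inequality_measure[where A = "{}"]) 
       (auto intro: integrable_measure_pmf_finite[OF finP])
  also have "\<dots> \<le> exp (s * \<mu> + s\<^sup>2 * V / 8) / exp (s * (\<mu> + t))"
    unfolding P_def \<mu>_def V_def
    by (intro divide_right_mono bounded_differences_mgf_le A s fin diff) auto
  also have "\<dots> = exp (s\<^sup>2 * V / 8 - s * t)"
    by (simp add: exp_diff[symmetric] algebra_simps)
  also have "s\<^sup>2 * V / 8 - s * t = - 2 * t\<^sup>2 / V"
    using V by (simp add: s_def field_simps power2_eq_square)
  finally show ?thesis unfolding P_def \<mu>_def V_def .
qed

subsection \<open>Moments of sums of i.i.d. vectors\<close>

lemma expectation_Pi_pmf_component_sum:
  fixes u :: "'b \<Rightarrow> 'c :: {banach, second_countable_topology}"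
  assumes "finite A" "finite (set_pmf p)"
  shows "measure_pmf.expectation (Pi_pmf A d (\<lambda>_. p)) (\<lambda>a. \<Sum>i\<in>A. u (a i)) =
    real (card A) *\<^sub>R measure_pmf.expectation p u"
proof -
  have "measure_pmf.expectation (Pi_pmf A d (\<lambda>_. p)) (\<lambda>a. u (a i)) = measure_pmf.expectation p u"
    if "i \<in> A" for i
  proof -
    have "measure_pmf.expectation (Pi_pmf A d (\<lambda>_. p)) (\<lambda>a. u (a i)) =
        measure_pmf.expectation (map_pmf (\<lambda>a. a i) (Pi_pmf A d (\<lambda>_. p))) u"
      by simp
    then show ?thesis using that assms by (simp add: Pi_pmf_component)
  qed
  then have "(\<Sum>i\<in>A. measure_pmf.expectation (Pi_pmf A d (\<lambda>_. p)) (\<lambda>a. u (a i))) =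
      real (card A) *\<^sub>R measure_pmf.expectation p u"
    by (simp add: scaleR_conv_of_real sum_constant_scaleR)
  then show ?thesis
    using assms by (subst Bochner_Integration.integral_sum)
      (auto intro!: integrable_measure_pmf_finite finite_set_Pi_pmf)
qed

text \<open>Variances of independent centred vectors add up: when one summand is split off and the
  square is expanded, the cross term is the inner product of \<open>u y\<close> with the mean of the
  remaining sum, which is 0.\<close>

lemma expectation_norm_sum_squared:
  fixes u :: "'b \<Rightarrow> 'c :: euclidean_space"
  assumes "finite A" and fin: "finite (set_pmf p)" and u: "measure_pmf.expectation p u = 0"
  shows "measure_pmf.expectation (Pi_pmf A d (\<lambda>_. p)) (\<lambda>a. (norm (\<Sum>i\<in>A. u (a i)))\<^sup>2) =
    real (card A) * measure_pmf.expectation p (\<lambda>x. (norm (u x))\<^sup>2)"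
  using assms(1)
proof (induction A rule: finite_induct)
  case empty
  then show ?case by simp
next
  case (insert i A)
  define P where "P = Pi_pmf A d (\<lambda>_. p)"
  have finP: "finite (set_pmf P)"
    unfolding P_def using insert fin by (intro finite_set_Pi_pmf) auto
  note int = integrable_measure_pmf_finite[OF finP] integrable_measure_pmf_finite[OF fin]
  define S where "S a = (\<Sum>j\<in>A. u (a j))" for a
  have upd: "(\<Sum>j\<in>insert i A. u ((a(i := y)) j)) = u y + S a" for a y
  proof -
    have "(\<Sum>j\<in>A. u ((a(i := y)) j)) = S a"
      unfolding S_def using insert.hyps by (intro sum.cong) auto
    then show ?thesis using insert.hyps by simp
  qed
  have ES: "measure_pmf.expectation P S = 0"
    unfolding P_def S_def using expectation_Pi_pmf_component_sum[OF insert.hyps(1) fin, of d u] u by simp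
  have "measure_pmf.expectation P (\<lambda>a. (norm (u y + S a))\<^sup>2) =
      (norm (u y))\<^sup>2 + measure_pmf.expectation P (\<lambda>a. (norm (S a))\<^sup>2)" for y
  proof -
    have "measure_pmf.expectation P (\<lambda>a. (norm (u y + S a))\<^sup>2) =
        measure_pmf.expectation P (\<lambda>a. (norm (u y))\<^sup>2 + 2 * (u y \<bullet> S a) + (norm (S a))\<^sup>2)"
      by (intro Bochner_Integration.integral_cong) (auto simp: power2_norm_eq_inner algebra_simps inner_commute)
    also have "\<dots> = (norm (u y))\<^sup>2 + 2 * measure_pmf.expectation P (\<lambda>a. u y \<bullet> S a)
        + measure_pmf.expectation P (\<lambda>a. (norm (S a))\<^sup>2)"
      by (simp add: int)
    also have "measure_pmf.expectation P (\<lambda>a. u y \<bullet> S a) = u y \<bullet> measure_pmf.expectation P S"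
      by (simp add: int)
    finally show ?thesis by (simp add: ES)
  qed
  then show ?case
    using insert fin
    by (subst expectation_Pi_pmf_insert)
       (auto simp: upd P_def[symmetric] S_def[symmetric] int algebra_simps simp del: fun_upd_apply)
qed

lemma expectation_norm_sum_le:
  fixes u :: "'b \<Rightarrow> 'c :: euclidean_space"
  assumes "finite A" and fin: "finite (set_pmf p)" and u: "measure_pmf.expectation p u = 0"
  shows "measure_pmf.expectation (Pi_pmf A d (\<lambda>_. p)) (\<lambda>a. norm (\<Sum>i\<in>A. u (a i))) \<le>
    sqrt (real (card A) * measure_pmf.expectation p (\<lambda>x. (norm (u x))\<^sup>2))"
proof -
  define P where "P = Pi_pmf A d (\<lambda>_. p)"
  have "finite (set_pmf P)"
    unfolding P_def using assms by (intro finite_set_Pi_pmf) auto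
  note int = integrable_measure_pmf_finite[OF this]
  let ?X = "\<lambda>a. norm (\<Sum>i\<in>A. u (a i))"
  \<comment> \<open>Jensen's inequality for the square, obtained from the nonnegativity of the
    variance.\<close>
  have "(measure_pmf.expectation P ?X)\<^sup>2 \<le> measure_pmf.expectation P (\<lambda>a. (?X a)\<^sup>2)"
    using measure_pmf.variance_positive[of P ?X] by (simp add: measure_pmf.variance_eq int)
  then show ?thesis
    unfolding P_def expectation_norm_sum_squared[OF assms] by (rule real_le_rsqrt)
qed

subsection \<open>Finite-valued independent variables as a product distribution\<close>

text \<open>Transfers events about the draws from an arbitrary probability space to
  \<open>Pi_pmf\<close>. Finitely many variables with finitely many values cut the event into
  finitely many disjoint atoms, and both measures assign to an atom the same product of marginal
  probabilities.\<close>

lemma (in prob_space) prob_indep_vars_eq_Pi_pmf: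
  fixes X :: "'i \<Rightarrow> 'a \<Rightarrow> 'b :: finite"
  assumes indep: "indep_vars (\<lambda>_. count_space UNIV) X I"
    and I: "finite I" "I \<noteq> {}"
    and p: "\<And>i t. i \<in> I \<Longrightarrow> prob {\<omega> \<in> space M. X i \<omega> = t} = pmf (p i) t"
  shows "prob {\<omega> \<in> space M. \<phi> (\<lambda>i. if i \<in> I then X i \<omega> else d)} =
    measure_pmf.prob (Pi_pmf I d p) {a. \<phi> a}"
proof -
  \<comment> \<open>Fixing the value \<open>d\<close> outside \<open>I\<close> makes
    \<open>Q\<close> finite, and distinct members of \<open>Q\<close> then differ inside
    \<open>I\<close>, so their atoms are disjoint.\<close>
  define Q where "Q = {a \<in> PiE_dflt I d (\<lambda>_. UNIV). \<phi> a}"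
  define B where "B a = (\<Inter>i\<in>I. X i -` {a i} \<inter> space M)" for a
  have finQ: "finite Q" 
    unfolding Q_def by (rule finite_subset[OF _ finite_PiE_dflt[OF I(1)]]) auto
  have "X i \<in> measurable M (count_space UNIV)" if "i \<in> I" for i
    using indep that by (auto simp: indep_vars_def)
  then have meas: "B a \<in> events" for a
    unfolding B_def using I by (intro sets.finite_INT) (auto intro: measurable_sets)
  have "{\<omega> \<in> space M. \<phi> (\<lambda>i. if i \<in> I then X i \<omega> else d)} = (\<Union>a\<in>Q. B a)"
  proof (intro set_eqI iffI)
    fix \<omega> assume "\<omega> \<in> {\<omega> \<in> space M. \<phi> (\<lambda>i. if i \<in> I then X i \<omega> else d)}"
    then show "\<omega> \<in> (\<Union>a\<in>Q. B a)"
      by (auto simp: Q_def B_def PiE_dflt_def intro!: exI[of _ "\<lambda>i. if i \<in> I then X i \<omega> else d"])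
  next
    fix \<omega> assume "\<omega> \<in> (\<Union>a\<in>Q. B a)"
    then obtain a where a: "a \<in> Q" "\<omega> \<in> B a" by auto
    then have "(\<lambda>i. if i \<in> I then X i \<omega> else d) = a"
      using I by (auto simp: Q_def B_def PiE_dflt_def fun_eq_iff)
    then show "\<omega> \<in> {\<omega> \<in> space M. \<phi> (\<lambda>i. if i \<in> I then X i \<omega> else d)}"
      using a I by (auto simp: Q_def B_def)
  qed
  moreover have "disjoint_family_on B Q"
    unfolding disjoint_family_on_def
  proof (intro ballI impI)
    fix a b assume ab: "a \<in> Q" "b \<in> Q" "a \<noteq> b"
    then obtain i where "a i \<noteq> b i" by blast
    moreover from this have "i \<in> I" using ab by (auto simp: Q_def PiE_dflt_def)
    ultimately show "B a \<inter> B b = {}" by (auto simp: B_def)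
  qed
  moreover have "B ` Q \<subseteq> events" using meas by blast
  ultimately have "prob {\<omega> \<in> space M. \<phi> (\<lambda>i. if i \<in> I then X i \<omega> else d)} = (\<Sum>a\<in>Q. prob (B a))"
    using finite_measure_finite_Union[OF finQ, of B] by (simp only:)
  also have "\<dots> = (\<Sum>a\<in>Q. pmf (Pi_pmf I d p) a)"
  proof (intro sum.cong refl)
    fix a assume a: "a \<in> Q"
    have "prob (B a) = (\<Prod>i\<in>I. prob (X i -` {a i} \<inter> space M))"
      unfolding B_def using I by (intro indep_varsD_finite[OF indep]) auto
    also have "\<dots> = (\<Prod>i\<in>I. pmf (p i) (a i))"
      using p by (intro prod.cong refl) (simp add: vimage_def Int_def conj_commute)
    also have "\<dots> = pmf (Pi_pmf I d p) a"
      using a I by (subst pmf_Pi') (auto simp: Q_def PiE_dflt_def)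
    finally show "prob (B a) = pmf (Pi_pmf I d p) a" .
  qed
  also have "\<dots> = measure_pmf.prob (Pi_pmf I d p) Q"
    using finQ by (simp add: measure_measure_pmf_finite)
  also have "\<dots> = measure_pmf.prob (Pi_pmf I d p) {a. \<phi> a}"
    \<comment> \<open>Functions that differ from \<open>d\<close> somewhere outside \<open>I\<close>
      have mass 0 under \<open>Pi_pmf\<close>.\<close>
    using I by (intro measure_prob_cong_0) (auto simp: Q_def PiE_dflt_def pmf_Pi)
  finally show ?thesis .
qed

subsection \<open>Feasible points and optimal values\<close>

text \<open>Passes from weights on draws to weights on distinct indices: an index drawn repeatedly
  receives the total weight of its draws.\<close>

lemma portfolio_sample_feasible_convex_combination:
  assumes "finite I" "\<And>k. k \<in> I \<Longrightarrow> W k \<ge> 0" "(\<Sum>k\<in>I. W k) = 1"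
  shows "(restrict (\<lambda>j. \<Sum>k | k \<in> I \<and> a k = j. W k) (a ` I), \<Sum>k\<in>I. W k *\<^sub>R \<alpha> (a k))
    \<in> portfolio_sample_feasible (a ` I) \<alpha>"
proof -
  have "(\<Sum>j\<in>a ` I. (\<Sum>k | k \<in> I \<and> a k = j. W k) *\<^sub>R \<alpha> j) =
      (\<Sum>j\<in>a ` I. \<Sum>k | k \<in> I \<and> a k = j. W k *\<^sub>R \<alpha> (a k))"
    by (simp add: scaleR_sum_left)
  also have "\<dots> = (\<Sum>k\<in>I. W k *\<^sub>R \<alpha> (a k))"
    using sum.image_gen[OF assms(1), of "\<lambda>k. W k *\<^sub>R \<alpha> (a k)" a] by simp
  moreover have "(\<Sum>j\<in>a ` I. \<Sum>k | k \<in> I \<and> a k = j. W k) = 1"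
    using sum.image_gen[OF assms(1), of W a] assms(3) by simp
  ultimately show ?thesis
    using assms(2) by (auto simp: portfolio_sample_feasible_def intro!: sum_nonneg)
qed

lemma norm_convex_combination_le:
  fixes v :: "'i \<Rightarrow> 'c :: real_normed_vector"
  assumes "\<And>k. k \<in> I \<Longrightarrow> W k \<ge> 0" "(\<Sum>k\<in>I. W k) = 1" "\<And>k. k \<in> I \<Longrightarrow> norm (v k) \<le> H"
  shows "norm (\<Sum>k\<in>I. W k *\<^sub>R v k) \<le> H"
proof -
  have "norm (\<Sum>k\<in>I. W k *\<^sub>R v k) \<le> (\<Sum>k\<in>I. W k * H)"
    using assms by (intro sum_norm_le) (auto intro!: mult_left_mono)
  then show ?thesis using assms(2) by (simp add: sum_distrib_right[symmetric])
qed

text \<open>A real infimum is a lower bound only for a set that is bounded below. Feasible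
  \<open>r'\<close> have norm at most \<open>H\<close>, so the Lipschitz condition gives the bound
  \<open>f 0 - L * H\<close>.\<close>

lemma optimal_value_sample_le:
  assumes \<alpha>: "\<And>j. norm (\<alpha> j) \<le> H" and f: "L-lipschitz_on UNIV f"
    and xr: "(x, r) \<in> portfolio_sample_feasible J \<alpha>"
  shows "optimal_value f (portfolio_sample_feasible J \<alpha>) \<le> f r"
proof -
  have "f 0 - L * H \<le> f r'" if "(x', r') \<in> portfolio_sample_feasible J \<alpha>" for x' r'
  proof -
    have "norm r' \<le> H"
      using that norm_convex_combination_le[of J x' \<alpha> H] \<alpha>
      by (auto simp: portfolio_sample_feasible_def)
    then have "L * norm r' \<le> L * H"
      using lipschitz_on_nonneg[OF f] by (intro mult_left_mono)
    then show ?thesis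
      using lipschitz_onD[OF f, of r' 0] by (auto simp: dist_norm)
  qed
  then have "bdd_below ((\<lambda>(x, r). f r) ` portfolio_sample_feasible J \<alpha>)"
    by (intro bdd_belowI2[of _ "f 0 - L * H"]) auto
  from cINF_lower[OF this xr] show ?thesis
    by (simp add: optimal_value_def)
qed

text \<open>Weierstrass: the feasible set is the continuous image of a compact slice of a
  box.\<close>

lemma optimal_value_distr_attained:
  fixes \<alpha> :: "'n::finite \<Rightarrow> real ^ 'm::finite" and \<xi> :: "real ^ 'n"
  assumes f: "continuous_on UNIV f" and C: "C \<ge> 1"
    and \<xi>: "\<And>t. \<xi> $ t \<ge> 0" "(\<Sum>t\<in>UNIV. \<xi> $ t) = 1"
  obtains x r where "(x, r) \<in> portfolio_distr_feasible C \<xi> \<alpha>"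
    and "optimal_value f (portfolio_distr_feasible C \<xi> \<alpha>) = f r"
proof -
  define S where "S = portfolio_distr_feasible C \<xi> \<alpha>"
  define X where "X = cbox 0 (C *\<^sub>R \<xi>) \<inter> {x. (\<Sum>j\<in>UNIV. x $ j) = 1}"
  have S_eq: "S = (\<lambda>x. (x, \<Sum>j\<in>UNIV. x $ j *\<^sub>R \<alpha> j)) ` X"
    by (auto simp: S_def X_def portfolio_distr_feasible_def mem_box_cart)
  have "compact X"
    unfolding X_def
    by (intro compact_Int_closed compact_cbox closed_Collect_eq continuous_intros)
  then have "compact S"
    unfolding S_eq by (intro compact_continuous_image continuous_intros)
  \<comment> \<open>Here \<open>C \<ge> 1\<close> enters: it makes \<xi> itself feasible.\<close>
  moreover have "\<xi> \<in> X"
    using \<xi> mult_right_mono[OF C \<xi>(1)] by (simp add: X_def mem_box_cart)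
  then have "S \<noteq> {}" unfolding S_eq by auto
  moreover have "continuous_on S (\<lambda>z. f (snd z))"
    by (intro continuous_on_compose2[OF f] continuous_intros) auto
  ultimately obtain z where z: "z \<in> S" "\<And>z'. z' \<in> S \<Longrightarrow> f (snd z) \<le> f (snd z')"
    using continuous_attains_inf[of S "\<lambda>z. f (snd z)"] by auto
  have "optimal_value f S = f (snd z)"
    unfolding optimal_value_def case_prod_beta
    using z by (intro cInf_eq_minimum) auto
  then show thesis
    using that[of "fst z" "snd z"] z(1) by (simp add: S_def)
qed

text \<open>The deterministic half of the argument, valid for every outcome \<open>a\<close> of the
  draws: normalizing the weights \<open>y (a k)\<close> gives a feasible point, whose distance to
  \<open>r\<close> is controlled by the two deviations.\<close>

lemma optimal_value_sample_le_reweighted: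
  fixes \<alpha> :: "'n::finite \<Rightarrow> real ^ 'm::finite"
  assumes \<alpha>: "\<And>j. norm (\<alpha> j) \<le> H" and f: "L-lipschitz_on UNIV f"
    and I: "finite I" "I \<noteq> {}" and y: "\<And>t. y t \<ge> 0" and r: "norm r \<le> H"
  shows "optimal_value f (portfolio_sample_feasible (a ` I) \<alpha>) \<le> f r +
    L * (H * \<bar>1 - (\<Sum>k\<in>I. y (a k)) / card I\<bar> +
         norm ((\<Sum>k\<in>I. y (a k) *\<^sub>R \<alpha> (a k)) /\<^sub>R card I - r))"
proof -
  define S where "S = (\<Sum>k\<in>I. y (a k)) / card I"
  define V where "V = (\<Sum>k\<in>I. y (a k) *\<^sub>R \<alpha> (a k)) /\<^sub>R card I"
  have L: "L \<ge> 0" using lipschitz_on_nonneg[OF f] .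
  have S: "S \<ge> 0" unfolding S_def by (intro divide_nonneg_nonneg sum_nonneg y) auto
  have card: "card I > 0" using I by (simp add: card_gt_0_iff)
  have "\<exists>W. (\<forall>k\<in>I. W k \<ge> 0) \<and> (\<Sum>k\<in>I. W k) = 1 \<and>
      norm ((\<Sum>k\<in>I. W k *\<^sub>R \<alpha> (a k)) - r) \<le> H * \<bar>1 - S\<bar> + norm (V - r)"
  proof (cases "S = 0")
    case True
    then have "(\<Sum>k\<in>I. y (a k)) = 0" using card by (simp add: S_def)
    then have "\<And>k. k \<in> I \<Longrightarrow> y (a k) = 0"
      using I y by (subst (asm) sum_nonneg_eq_0_iff) auto
    then have V: "V = 0" by (simp add: V_def)
    \<comment> \<open>Here \<open>\<bar>1 - S\<bar> = 1\<close>, so the bound is \<open>H + \<parallel>r\<parallel>\<close> and any feasible point will do.\<close>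
    let ?W = "\<lambda>_. 1 / real (card I)"
    have W: "(\<Sum>k\<in>I. ?W k) = 1" using card by simp
    have "norm ((\<Sum>k\<in>I. ?W k *\<^sub>R \<alpha> (a k)) - r) \<le> H + norm r"
      using norm_convex_combination_le[OF _ W, of "\<lambda>k. \<alpha> (a k)" H] \<alpha>
      by (intro order.trans[OF norm_triangle_ineq4] add_right_mono) auto
    then show ?thesis using True V W by (intro exI[of _ ?W] conjI ballI) simp_all
  next
    case False
    let ?W = "\<lambda>k. y (a k) / (card I * S)"
    have W: "(\<Sum>k\<in>I. ?W k) = 1"
      using False card by (simp add: S_def sum_divide_distrib[symmetric])
    have pos: "?W k \<ge> 0" for k using S y by simp
    define R where "R = (\<Sum>k\<in>I. ?W k *\<^sub>R \<alpha> (a k))"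
    have R: "norm R \<le> H"
      unfolding R_def using \<alpha> by (intro norm_convex_combination_le pos W) auto
    have "V = S *\<^sub>R R"
      unfolding V_def R_def scaleR_sum_right using False by (intro sum.cong) (auto simp: field_simps)
    \<comment> \<open>The normalization error is expressed through \<open>R\<close> rather than
      \<open>V\<close>: as a convex combination, \<open>R\<close> has norm at most \<open>H\<close>,
      with no factor from the size of \<open>y\<close>.\<close>
    then have "R - r = (1 - S) *\<^sub>R R + (V - r)"
      by (simp add: algebra_simps)
    then have "norm (R - r) \<le> \<bar>1 - S\<bar> * norm R + norm (V - r)"
      by (metis norm_scaleR norm_triangle_ineq)
    also have "\<dots> \<le> H * \<bar>1 - S\<bar> + norm (V - r)"
      using R by (auto simp: mult.commute intro!: mult_right_mono)
    finally show ?thesis using W pos unfolding R_def by (intro exI[of _ ?W]) auto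
  qed
  then obtain W where W: "\<And>k. k \<in> I \<Longrightarrow> W k \<ge> 0" "(\<Sum>k\<in>I. W k) = 1"
    and le: "norm ((\<Sum>k\<in>I. W k *\<^sub>R \<alpha> (a k)) - r) \<le> H * \<bar>1 - S\<bar> + norm (V - r)"
    by auto
  have "optimal_value f (portfolio_sample_feasible (a ` I) \<alpha>) \<le> f (\<Sum>k\<in>I. W k *\<^sub>R \<alpha> (a k))"
    by (intro optimal_value_sample_le[OF \<alpha> f portfolio_sample_feasible_convex_combination] I W)
  also have "\<dots> \<le> f r + L * norm ((\<Sum>k\<in>I. W k *\<^sub>R \<alpha> (a k)) - r)"
    using lipschitz_onD[OF f, of "\<Sum>k\<in>I. W k *\<^sub>R \<alpha> (a k)" r] by (auto simp: dist_norm)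
  also have "\<dots> \<le> f r + L * (H * \<bar>1 - S\<bar> + norm (V - r))"
    using le L by (intro add_left_mono mult_left_mono)
  finally show ?thesis unfolding S_def V_def .
qed

subsection \<open>Deviation of sample means\<close>

lemma sum_fun_upd_diff:
  fixes u :: "'b \<Rightarrow> 'c :: ab_group_add"
  assumes "finite I" "i \<in> I"
  shows "(\<Sum>k\<in>I. u ((a(i := y)) k)) - (\<Sum>k\<in>I. u ((a(i := z)) k)) = u y - u z"
proof -
  have "(\<Sum>k\<in>I. u ((a(i := x)) k)) = u x + (\<Sum>k\<in>I - {i}. u (a k))" for x
    using assms by (subst sum.remove[of _ i]) (auto intro!: sum.cong)
  then show ?thesis by simp
qed

text \<open>Redrawing one index moves the sum by at most \<open>C\<close>. A threshold proportional
  to \<open>C * sqrt (card I)\<close> cancels the sum of squared differences, so the exponent does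
  not depend on the sample size.\<close>

lemma prob_sample_sum_ge:
  fixes y :: "'b \<Rightarrow> real"
  assumes I: "finite I" "I \<noteq> {}" and fin: "finite (set_pmf p)"
    and y: "\<And>s t. s \<in> set_pmf p \<Longrightarrow> t \<in> set_pmf p \<Longrightarrow> y s - y t \<le> C"
    and C: "C > 0" and \<tau>: "\<tau> > 0"
  shows "measure_pmf.prob (Pi_pmf I d (\<lambda>_. p))
      {a. (\<Sum>k\<in>I. y (a k)) \<ge> card I * measure_pmf.expectation p y + C * sqrt (card I) * \<tau>}
    \<le> exp (- 2 * \<tau>\<^sup>2)"
proof -
  have card: "card I > 0" using I by (simp add: card_gt_0_iff)
  have "measure_pmf.expectation (Pi_pmf I d (\<lambda>_. p)) (\<lambda>a. \<Sum>k\<in>I. y (a k)) =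
      card I * measure_pmf.expectation p y"
    using expectation_Pi_pmf_component_sum[OF I(1) fin, of d y] by simp
  moreover have "- 2 * (C * sqrt (card I) * \<tau>)\<^sup>2 / (\<Sum>k\<in>I. C\<^sup>2) = - 2 * \<tau>\<^sup>2"
    using C card by (simp add: power_mult_distrib)
  moreover have "measure_pmf.prob (Pi_pmf I d (\<lambda>_. p))
      {a. (\<Sum>k\<in>I. y (a k)) \<ge> measure_pmf.expectation (Pi_pmf I d (\<lambda>_. p)) (\<lambda>a. \<Sum>k\<in>I. y (a k))
            + C * sqrt (card I) * \<tau>}
      \<le> exp (- 2 * (C * sqrt (card I) * \<tau>)\<^sup>2 / (\<Sum>k\<in>I. C\<^sup>2))"
    using C card \<tau> I
    by (intro McDiarmid_inequality_pmf) (auto simp: sum_fun_upd_diff y fin simp del: fun_upd_apply)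
  ultimately show ?thesis by simp
qed

text \<open>The one-sided bound is applied to \<open>y\<close> and to \<open>- y\<close>, and the
  two tails are added.\<close>

lemma prob_sample_mean_deviation:
  fixes y :: "'b \<Rightarrow> real"
  assumes I: "finite I" "I \<noteq> {}" and fin: "finite (set_pmf p)"
    and y: "\<And>s t. s \<in> set_pmf p \<Longrightarrow> t \<in> set_pmf p \<Longrightarrow> y s - y t \<le> C"
    and C: "C > 0" and \<tau>: "\<tau> > 0"
  shows "measure_pmf.prob (Pi_pmf I d (\<lambda>_. p))
      {a. \<bar>measure_pmf.expectation p y - (\<Sum>k\<in>I. y (a k)) / card I\<bar> > C / sqrt (card I) * \<tau>}
    \<le> 2 * exp (- 2 * \<tau>\<^sup>2)"
proof -
  define n where "n = real (card I)"
  have n: "n > 0" using I by (simp add: n_def card_gt_0_iff)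
  define P where "P = Pi_pmf I d (\<lambda>_. p)"
  define \<mu> where "\<mu> = measure_pmf.expectation p y"
  let ?U = "{a. (\<Sum>k\<in>I. y (a k)) \<ge> n * \<mu> + C * sqrt n * \<tau>}"
  let ?D = "{a. (\<Sum>k\<in>I. - y (a k)) \<ge> n * - \<mu> + C * sqrt n * \<tau>}"
  have U: "measure_pmf.prob P ?U \<le> exp (- 2 * \<tau>\<^sup>2)"
    unfolding P_def n_def \<mu>_def by (intro prob_sample_sum_ge assms)
  have D: "measure_pmf.prob P ?D \<le> exp (- 2 * \<tau>\<^sup>2)"
    using prob_sample_sum_ge[OF I fin _ C \<tau>, of "\<lambda>t. - y t" d] y
    by (simp add: P_def n_def \<mu>_def)
  have "{a. \<bar>\<mu> - (\<Sum>k\<in>I. y (a k)) / n\<bar> > C / sqrt n * \<tau>} \<subseteq> ?U \<union> ?D"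
  proof
    fix a assume "a \<in> {a. \<bar>\<mu> - (\<Sum>k\<in>I. y (a k)) / n\<bar> > C / sqrt n * \<tau>}"
    then have "n * \<bar>\<mu> - (\<Sum>k\<in>I. y (a k)) / n\<bar> > n * (C / sqrt n * \<tau>)"
      using n by (intro mult_strict_left_mono) simp_all
    moreover have "n * (C / sqrt n * \<tau>) = C * sqrt n * \<tau>"
      using real_div_sqrt[of n] n by (simp add: field_simps)
    moreover have "n * \<bar>\<mu> - (\<Sum>k\<in>I. y (a k)) / n\<bar> = \<bar>n * \<mu> - (\<Sum>k\<in>I. y (a k))\<bar>"
      using n by (simp add: abs_mult_pos' right_diff_distrib)
    ultimately show "a \<in> ?U \<union> ?D" by (auto simp: sum_negf)
  qed
  then have "measure_pmf.prob P {a. \<bar>\<mu> - (\<Sum>k\<in>I. y (a k)) / n\<bar> > C / sqrt n * \<tau>}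
      \<le> measure_pmf.prob P (?U \<union> ?D)"
    by (intro measure_pmf.finite_measure_mono) auto
  also have "\<dots> \<le> measure_pmf.prob P ?U + measure_pmf.prob P ?D"
    by (intro measure_Un_le) auto
  finally show ?thesis
    using U D by (simp add: P_def n_def \<mu>_def)
qed

text \<open>In \<open>1 + 2 * \<tau>\<close>, the 1 pays for the expected norm, bounded through the
  variance, and the 2 comes from McDiarmid's inequality with differences
  \<open>2 * B\<close>.\<close>

lemma prob_sample_mean_norm_deviation:
  fixes v :: "'b \<Rightarrow> 'c :: euclidean_space"
  assumes I: "finite I" "I \<noteq> {}" and fin: "finite (set_pmf p)"
    and v: "\<And>t. t \<in> set_pmf p \<Longrightarrow> norm (v t) \<le> B" and B: "B > 0" and \<tau>: "\<tau> > 0"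
  shows "measure_pmf.prob (Pi_pmf I d (\<lambda>_. p))
      {a. norm ((\<Sum>k\<in>I. v (a k)) /\<^sub>R card I - measure_pmf.expectation p v)
            > B / sqrt (card I) * (1 + 2 * \<tau>)}
    \<le> exp (- 2 * \<tau>\<^sup>2)"
proof -
  define n where "n = real (card I)"
  have n: "n > 0" using I by (simp add: n_def card_gt_0_iff)
  define P where "P = Pi_pmf I d (\<lambda>_. p)"
  define r where "r = measure_pmf.expectation p v"
  define u where "u t = v t - r" for t
  note int = integrable_measure_pmf_finite[OF fin]
  have Eu: "measure_pmf.expectation p u = 0"
    unfolding u_def by (simp add: int r_def)
  have "measure_pmf.expectation p (\<lambda>t. (norm (u t))\<^sup>2) =
      measure_pmf.expectation p (\<lambda>t. (norm (v t))\<^sup>2 - 2 * (r \<bullet> v t) + (norm r)\<^sup>2)"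
    by (intro Bochner_Integration.integral_cong)
       (auto simp: u_def power2_norm_eq_inner algebra_simps inner_commute)
  also have "\<dots> = measure_pmf.expectation p (\<lambda>t. (norm (v t))\<^sup>2) - (norm r)\<^sup>2"
    by (simp add: int r_def power2_norm_eq_inner)
  also have "\<dots> \<le> measure_pmf.expectation p (\<lambda>t. (norm (v t))\<^sup>2)"
    by simp
  also have "\<dots> \<le> measure_pmf.expectation p (\<lambda>t. B\<^sup>2)"
    by (intro integral_mono_AE int AE_pmfI power_mono v) auto
  finally have var: "measure_pmf.expectation p (\<lambda>t. (norm (u t))\<^sup>2) \<le> B\<^sup>2" by simp
  define h where "h a = norm (\<Sum>k\<in>I. u (a k))" for a
  have "measure_pmf.expectation P h \<le> sqrt (n * measure_pmf.expectation p (\<lambda>t. (norm (u t))\<^sup>2))"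
    unfolding P_def n_def h_def by (intro expectation_norm_sum_le I fin Eu)
  also have "\<dots> \<le> sqrt (n * B\<^sup>2)"
    using var n by simp
  also have "\<dots> = B * sqrt n"
    using B by (simp add: real_sqrt_mult)
  finally have Eh: "measure_pmf.expectation P h \<le> B * sqrt n" .
  have "measure_pmf.prob P {a. h a \<ge> measure_pmf.expectation P h + 2 * B * sqrt n * \<tau>}
      \<le> exp (- 2 * (2 * B * sqrt n * \<tau>)\<^sup>2 / (\<Sum>k\<in>I. (2 * B)\<^sup>2))"
    unfolding P_def
  proof (rule McDiarmid_inequality_pmf)
    \<comment> \<open>The centring term \<open>r\<close> cancels in \<open>u y - u z\<close>, so the
      difference is at most \<open>2 * B\<close>; bounding \<open>u y\<close> and \<open>u z\<close>
      separately by \<open>2 * B\<close> would give only \<open>4 * B\<close>.\<close>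
    fix i a y z assume "i \<in> I" and yz: "y \<in> set_pmf p" "z \<in> set_pmf p"
    then have "h (a(i := y)) - h (a(i := z)) \<le> norm (u y - u z)"
      unfolding h_def by (metis I(1) norm_triangle_ineq2 sum_fun_upd_diff)
    also have "\<dots> \<le> norm (v y) + norm (v z)"
      by (simp add: u_def norm_triangle_ineq4)
    also have "\<dots> \<le> 2 * B"
      using v[OF yz(1)] v[OF yz(2)] by simp
    finally show "h (a(i := y)) - h (a(i := z)) \<le> 2 * B" .
  qed (use n B \<tau> I fin in \<open>auto simp: n_def\<close>)
  also have "- 2 * (2 * B * sqrt n * \<tau>)\<^sup>2 / (\<Sum>k\<in>I. (2 * B)\<^sup>2) = - 2 * \<tau>\<^sup>2"
    using B n by (simp add: power_mult_distrib n_def)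
  finally have tail: "measure_pmf.prob P {a. h a \<ge> measure_pmf.expectation P h + 2 * B * sqrt n * \<tau>}
      \<le> exp (- 2 * \<tau>\<^sup>2)" .
  have "{a. norm ((\<Sum>k\<in>I. v (a k)) /\<^sub>R n - r) > B / sqrt n * (1 + 2 * \<tau>)}
      \<subseteq> {a. h a \<ge> measure_pmf.expectation P h + 2 * B * sqrt n * \<tau>}"
  proof
    fix a assume "a \<in> {a. norm ((\<Sum>k\<in>I. v (a k)) /\<^sub>R n - r) > B / sqrt n * (1 + 2 * \<tau>)}"
    then have "n * norm ((\<Sum>k\<in>I. v (a k)) /\<^sub>R n - r) > n * (B / sqrt n * (1 + 2 * \<tau>))"
      using n by (intro mult_strict_left_mono) simp_all
    moreover have "n * (B / sqrt n * (1 + 2 * \<tau>)) = B * sqrt n + 2 * B * sqrt n * \<tau>"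
      using real_div_sqrt[of n] n by (simp add: field_simps)
    moreover have "(\<Sum>k\<in>I. u (a k)) = n *\<^sub>R ((\<Sum>k\<in>I. v (a k)) /\<^sub>R n - r)"
      using n by (simp add: u_def sum_subtractf sum_constant_scaleR n_def[symmetric] scaleR_diff_right)
    then have "n * norm ((\<Sum>k\<in>I. v (a k)) /\<^sub>R n - r) = h a"
      using n by (simp add: h_def)
    ultimately show "a \<in> {a. h a \<ge> measure_pmf.expectation P h + 2 * B * sqrt n * \<tau>}"
      using Eh by auto
  qed
  then have "measure_pmf.prob P {a. norm ((\<Sum>k\<in>I. v (a k)) /\<^sub>R n - r) > B / sqrt n * (1 + 2 * \<tau>)}
      \<le> measure_pmf.prob P {a. h a \<ge> measure_pmf.expectation P h + 2 * B * sqrt n * \<tau>}"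
    by (intro measure_pmf.finite_measure_mono) auto
  also note tail
  finally show ?thesis unfolding P_def n_def r_def .
qed

text \<open>Union bound over two failure events: the thresholds \<tau> and
  \<open>1 + 2 * \<tau>\<close> add up to \<open>1 + 3 * \<tau>\<close>, and the three tails
  together have probability at most \<open>3 * \<delta> / 4\<close>.\<close>

lemma prob_reweighted_sample_deviation:
  fixes \<alpha> :: "'n::finite \<Rightarrow> 'c :: euclidean_space" and y :: "'n \<Rightarrow> real"
  assumes I: "finite I" "I \<noteq> {}" and \<alpha>: "\<And>j. norm (\<alpha> j) \<le> H"
    and y: "\<And>t. 0 \<le> y t" "\<And>t. y t \<le> C" and C: "C > 0"
    and Ey: "measure_pmf.expectation p y = 1"
    and \<delta>: "0 < \<delta>" "\<delta> < 1"
  shows "measure_pmf.prob (Pi_pmf I d (\<lambda>_. p))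
      {a. H * \<bar>1 - (\<Sum>k\<in>I. y (a k)) / card I\<bar> +
          norm ((\<Sum>k\<in>I. y (a k) *\<^sub>R \<alpha> (a k)) /\<^sub>R card I - measure_pmf.expectation p (\<lambda>t. y t *\<^sub>R \<alpha> t))
        > C * H / sqrt (card I) * (1 + 3 * sqrt (1 / 2 * ln (4 / \<delta>)))}
    \<le> \<delta>" (is "measure_pmf.prob ?P ?bad \<le> \<delta>")
proof -
  define \<tau> where "\<tau> = sqrt (1 / 2 * ln (4 / \<delta>))"
  have "ln (4 / \<delta>) > 0" using \<delta> by (intro ln_gt_zero) simp
  then have \<tau>: "\<tau> > 0" and "2 * \<tau>\<^sup>2 = ln (4 / \<delta>)"
    by (simp_all add: \<tau>_def)
  then have exp: "exp (- 2 * \<tau>\<^sup>2) = \<delta> / 4"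
    using \<delta> by (simp add: exp_minus)
  have H: "H \<ge> 0" using norm_ge_zero \<alpha> order.trans by blast
  define V where "V a = norm ((\<Sum>k\<in>I. y (a k) *\<^sub>R \<alpha> (a k)) /\<^sub>R card I
    - measure_pmf.expectation p (\<lambda>t. y t *\<^sub>R \<alpha> t))" for a
  define S where "S a = \<bar>1 - (\<Sum>k\<in>I. y (a k)) / card I\<bar>" for a
  show ?thesis
  \<comment> \<open>The norm deviation bound is applied with radius \<open>C * H\<close>, which must
    be positive. For \<open>H = 0\<close> all vectors vanish and the bad event is empty.\<close>
  proof (cases "H = 0")
    case True
    then have "\<alpha> = (\<lambda>_. 0)" using \<alpha> by (auto simp: fun_eq_iff)
    then show ?thesis using True \<delta> by simp
  next
    case False
    let ?A = "{a. S a > C / sqrt (card I) * \<tau>}"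
    let ?B = "{a. V a > C * H / sqrt (card I) * (1 + 2 * \<tau>)}"
    have "y s - y t \<le> C" for s t
      using y(2)[of s] y(1)[of t] by simp
    then have A: "measure_pmf.prob ?P ?A \<le> 2 * exp (- 2 * \<tau>\<^sup>2)"
      using prob_sample_mean_deviation[OF I, of p y C \<tau> d] C \<tau> by (simp add: Ey S_def)
    have B: "measure_pmf.prob ?P ?B \<le> exp (- 2 * \<tau>\<^sup>2)"
      unfolding V_def using H False C \<tau> I
      by (intro prob_sample_mean_norm_deviation) (auto intro!: mult_mono y \<alpha> simp: y)
    have "?bad \<subseteq> ?A \<union> ?B"
    proof (rule ccontr)
      assume "\<not> ?bad \<subseteq> ?A \<union> ?B"
      then obtain a where a: "a \<in> ?bad" "S a \<le> C / sqrt (card I) * \<tau>"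
        "V a \<le> C * H / sqrt (card I) * (1 + 2 * \<tau>)" by force
      have "H * S a + V a \<le> H * (C / sqrt (card I) * \<tau>) + C * H / sqrt (card I) * (1 + 2 * \<tau>)"
        using a H by (intro add_mono mult_left_mono)
      also have "\<dots> = C * H / sqrt (card I) * (1 + 3 * \<tau>)"
        by (simp add: field_simps add_divide_distrib)
      finally show False using a(1) by (simp add: \<tau>_def S_def V_def)
    qed
    then have "measure_pmf.prob ?P ?bad \<le> measure_pmf.prob ?P (?A \<union> ?B)"
      by (intro measure_pmf.finite_measure_mono) auto
    also have "\<dots> \<le> measure_pmf.prob ?P ?A + measure_pmf.prob ?P ?B"
      by (intro measure_Un_le) auto
    finally show ?thesis using A B exp \<delta> by simp
  qed
qed

section \<open>Importance weighting of an optimal restricted portfolio, and transfer to the given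
  probability space\<close>

theorem mainTheorem11:
  fixes \<alpha> :: "'n::finite \<Rightarrow> real ^ 'm::finite"
    and f :: "real ^ 'm \<Rightarrow> real"
    and \<xi> :: "real ^ 'n"
    and L H C \<delta> :: real
    and K :: nat
    and M :: "'a measure"
    and js :: "nat \<Rightarrow> 'a \<Rightarrow> 'n"
  defines "F \<equiv> optimal_value f (portfolio_feasible \<alpha>)"
    and "F_distr \<equiv> optimal_value f (portfolio_distr_feasible C \<xi> \<alpha>)"
    and "F_J \<equiv> \<lambda>\<omega>. optimal_value f (portfolio_sample_feasible ((\<lambda>k. js k \<omega>) ` {1..K}) \<alpha>)"
  assumes "\<And>j. norm (\<alpha> j) \<le> H"
    and "L-lipschitz_on UNIV f"
    and "C \<ge> 1"
    and "\<And>t. \<xi> $ t \<ge> 0" and "(\<Sum>t\<in>UNIV. \<xi> $ t) = 1"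
    and "K \<ge> 1"
    and "prob_space M"
    and "prob_space.indep_vars M (\<lambda>_. count_space UNIV) js {1..K}"
    and "\<And>k t. k \<in> {1..K} \<Longrightarrow> measure M {\<omega> \<in> space M. js k \<omega> = t} = \<xi> $ t"
    and "0 < \<delta>" and "\<delta> < 1"
  shows "measure M {\<omega> \<in> space M.
           F_J \<omega> - F \<le> (F_distr - F) + C * L * H / sqrt (real K) * (1 + 3 * sqrt (1 / 2 * ln (4 / \<delta>)))}
         \<ge> 1 - \<delta>"
proof -
  interpret prob_space M by fact
  note \<alpha> = assms(4) and f = assms(5) and C = assms(6) and \<xi> = assms(7,8) and K = assms(9)
  define I where "I = {1..K}"
  have I: "finite I" "I \<noteq> {}" "card I = K" using K by (auto simp: I_def)
  have L: "L \<ge> 0" using lipschitz_on_nonneg[OF f] .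
  define p where "p = embed_pmf (\<lambda>t. \<xi> $ t)"
  have p: "pmf p t = \<xi> $ t" for t
    unfolding p_def using \<xi>
    by (intro pmf_embed_pmf) (simp_all add: nn_integral_count_space_finite sum_ennreal)
  obtain x r where xr: "(x, r) \<in> portfolio_distr_feasible C \<xi> \<alpha>" and F_distr: "F_distr = f r"
    unfolding F_distr_def
    using optimal_value_distr_attained[OF lipschitz_on_continuous_on[OF f] C \<xi>] by metis
  then have r: "(\<Sum>j\<in>UNIV. x $ j *\<^sub>R \<alpha> j) = r" and x1: "(\<Sum>j\<in>UNIV. x $ j) = 1"
    and x: "\<And>j. 0 \<le> x $ j" "\<And>j. x $ j \<le> C * \<xi> $ j"
    by (auto simp: portfolio_distr_feasible_def)
  \<comment> \<open>Importance weights: averaging \<open>y\<close> against \<xi> recovers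
    \<open>x\<close>. Where \<open>\<xi> $ t = 0\<close> the quotient is 0 by convention, so it
    still lies between 0 and \<open>C\<close>.\<close>
  define y where "y t = x $ t / \<xi> $ t" for t
  have y: "y t \<ge> 0" "y t \<le> C" for t
    using x[of t] \<xi>(1)[of t] C by (auto simp: y_def divide_simps)
  \<comment> \<open>If \<open>\<xi> $ t = 0\<close>, then \<open>x $ t \<le> C * \<xi> $ t\<close> forces \<open>x $ t = 0\<close>.\<close>
  have xy: "\<xi> $ t * y t = x $ t" for t
    using x[of t] by (auto simp: y_def)
  have Ey: "measure_pmf.expectation p y = 1"
    using x1 by (simp add: integral_measure_pmf[of UNIV] p xy)
  have Eya: "measure_pmf.expectation p (\<lambda>t. y t *\<^sub>R \<alpha> t) = r"
    using r by (simp add: integral_measure_pmf[of UNIV] p xy)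
  have norm_r: "norm r \<le> H"
    unfolding r[symmetric] by (intro norm_convex_combination_le x x1 \<alpha>)
  define \<epsilon> where "\<epsilon> = C * H / sqrt K * (1 + 3 * sqrt (1 / 2 * ln (4 / \<delta>)))"
  define dev where "dev a = H * \<bar>1 - (\<Sum>k\<in>I. y (a k)) / card I\<bar> +
    norm ((\<Sum>k\<in>I. y (a k) *\<^sub>R \<alpha> (a k)) /\<^sub>R card I - r)" for a
  define G where "G a \<longleftrightarrow> optimal_value f (portfolio_sample_feasible (a ` I) \<alpha>) - F
    \<le> (F_distr - F) + C * L * H / sqrt K * (1 + 3 * sqrt (1 / 2 * ln (4 / \<delta>)))" for a
  let ?P = "Pi_pmf I undefined (\<lambda>_. p)"
  \<comment> \<open>After cancelling \<open>F\<close> on both sides, \<open>G a\<close> says that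
    the sampled optimum is at most \<open>f r + L * \<epsilon>\<close>.\<close>
  have "G a" if "dev a \<le> \<epsilon>" for a
  proof -
    have "optimal_value f (portfolio_sample_feasible (a ` I) \<alpha>) \<le> f r + L * dev a"
      unfolding dev_def by (intro optimal_value_sample_le_reweighted \<alpha> f I y norm_r)
    also have "\<dots> \<le> f r + L * \<epsilon>"
      using that L by (intro add_left_mono mult_left_mono)
    finally show ?thesis by (simp add: G_def F_distr \<epsilon>_def mult_ac)
  qed
  then have "measure_pmf.prob ?P {a. dev a \<le> \<epsilon>} \<le> measure_pmf.prob ?P {a. G a}"
    by (intro measure_pmf.finite_measure_mono) auto
  moreover have "measure_pmf.prob ?P {a. dev a > \<epsilon>} \<le> \<delta>"
    using prob_reweighted_sample_deviation[where \<alpha> = \<alpha>, OF I(1,2) \<alpha> y _ Ey assms(13,14), of undefined] C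
    unfolding dev_def \<epsilon>_def Eya I(3) by simp
  moreover have "measure_pmf.prob ?P {a. dev a \<le> \<epsilon>} = 1 - measure_pmf.prob ?P {a. dev a > \<epsilon>}"
    using measure_pmf.prob_compl[of "{a. dev a > \<epsilon>}" ?P]
    by (simp add: Compl_eq_Diff_UNIV[symmetric] Collect_neg_eq[symmetric] not_less)
  moreover have "measure_pmf.prob ?P {a. G a} =
      prob {\<omega> \<in> space M. G (\<lambda>k. if k \<in> I then js k \<omega> else undefined)}"
    using assms(11,12) I by (intro prob_indep_vars_eq_Pi_pmf[symmetric]) (auto simp: I_def p)
  \<comment> \<open>\<open>G a\<close> depends on \<open>a\<close> only through the image of
    \<open>I\<close>, so the default value never enters the event.\<close>
  moreover have "(\<lambda>k. if k \<in> I then js k \<omega> else undefined) ` I = (\<lambda>k. js k \<omega>) ` {1..K}" for \<omega>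
    by (auto simp: I_def)
  ultimately show ?thesis
    by (simp add: G_def F_J_def)
qed

end
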